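(* Let $\alpha,\beta>0$ satisfy $\min(\alpha,\beta)+1>\max(\alpha,\beta)$, and put $\rho=\frac{1-\sqrt{1+4\alpha\beta}}{2}$. Let $A$, $B$ and $X$ be independent positive random variables such that $A$ has distribution $D(\alpha,\beta;\alpha+1,\beta+1)$ and $B$ has distribution $\gamma_2=D(2;-)$. Then $X$ and $A(X+B)$ have the same distribution if and only if $X$ has the distribution $$D(\alpha+\rho,\beta+\rho;\alpha+\beta+1) * D(-\rho;-),$$ where $*$ denotes the (additive) convolution of probability measures on the real line.
   Context: For finite sequences of positive numbers $\mathbf a=(a_1,\dots,a_p)$ and $\mathbf b=(b_1,\dots,b_q)$ (with $p,q\ge 0$), write $(\mathbf a)_s=\prod_{j=1}^p \frac{\Gamma(a_j+s)}{\Gamma(a_j)}$, with $(\mathbf a)_s=1$ if $p=0$. The Dufresne law $D(a_1,\dots,a_p;b_1,\dots,b_q)$, if it exists, is the probability distribution on $(0,\infty)$ with Mellin transform $\int_0^\infty x^s\,D(\mathbf a;\mathbf b)(dx)=\frac{(\mathbf a)_s}{(\mathbf b)_s}$ for all $s$ such that all $a_j+s$ and $b_i+s$ are positive. A dash means that the corresponding sequence is empty. For $c>0$, $D(c;-)=\gamma_c$ is the gamma distribution $\gamma_c(dx)=\frac{1}{\Gamma(c)}x^{c-1}e^{-x}\mathbf 1_{(0,\infty)}(x)\,dx$. For $a,b>0$, $D(a;a+b)=\beta_{a,b}$ is the beta distribution $\beta_{a,b}(dx)=\frac{\Gamma(a+b)}{\Gamma(a)\Gamma(b)}x^{a-1}(1-x)^{b-1}\mathbf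 1_{(0,1)}(x)\,dx$. In particular $D(\alpha,\beta;\alpha+1,\beta+1)$ is the distribution of the product of two independent random variables with distributions $\beta_{\alpha,1}$ and $\beta_{\beta,1}$. *)

theory Defs
  imports "HOL-Probability.Probability"
begin

definition gamma_quotient :: "real list \<Rightarrow> real \<Rightarrow> real" where
  "gamma_quotient as s = (\<Prod>a\<leftarrow>as. Gamma (a + s) / Gamma a)"

(* The integral over (0,\<infinity>) is the integral over the whole line, since D is carried by (0,\<infinity>). *)
definition is_dufresne_law :: "real list \<Rightarrow> real list \<Rightarrow> real measure \<Rightarrow> bool" where
  "is_dufresne_law as bs D \<longleftrightarrow>
     (\<forall>a\<in>set as. 0 < a) \<and> (\<forall>b\<in>set bs. 0 < b) \<and>
     prob_space D \<and> sets D = sets borel \<and> (AE x in D. 0 < x) \<and>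
     (\<forall>s. (\<forall>a\<in>set as. 0 < a + s) \<and> (\<forall>b\<in>set bs. 0 < b + s) \<longrightarrow>
        has_bochner_integral D (\<lambda>x. x powr s) (gamma_quotient as s / gamma_quotient bs s))"

(* A law with this Mellin transform need not exist for given parameters, but there is at most
   one: all parameters are positive, so the transform is prescribed on a neighbourhood of 0. *)
definition dufresne :: "real list \<Rightarrow> real list \<Rightarrow> real measure" where
  "dufresne as bs = (THE D. is_dufresne_law as bs D)"

end

theory Submission
  imports Defs "HOL-Complex_Analysis.Complex_Analysis" "HOL-Real_Asymp.Real_Asymp"
begin

text \<open>
  Write T for the map sending the law of X to that of A(X + B). Since 0 < A < 1 almost surely, T has
  at most one fixed point: for two fixed points, the distance h(t) between their characteristic functions
  satisfies h(t) \<le> E h(tA), so a positive maximum of h on a segment [0, t], taken at the point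
  closest to 0, would be strictly less than itself. The proposed law is a fixed point because it has
  the same moments as its image, and these grow slowly enough to determine a law on the half line. Its
  exponential generating function of moments is \<open>\<phi> = (1 - x)\<^sup>\<rho> F(\<alpha> + \<rho>, \<beta> + \<rho>; \<alpha> + \<beta> + 1; x)\<close>, where F is Gauss's
  series, and as A has n-th moment \<open>\<alpha>\<beta> / ((\<alpha> + n)(\<beta> + n))\<close>, invariance amounts to the differential equation
  \<open>(\<theta> + \<alpha>)(\<theta> + \<beta>)\<phi> = \<alpha>\<beta> (1 - x)\<^bsup>-2\<^esup> \<phi>\<close> with \<open>\<theta> = x d/dx\<close>, which follows from the hypergeometric
  equation and \<open>\<rho>\<^sup>2 - \<rho> = \<alpha>\<beta>\<close>.
\<close>

subsection \<open>Uniqueness from exponential moments\<close>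

lemma norm_exp_times_of_real: "norm (exp (z * complex_of_real x)) = exp (Re z * x)"
  by (simp add: norm_exp_eq_Re)

text \<open>Near \<open>z\<close> the integrand expands in powers of \<open>w - z\<close>; termwise
  integration by dominated convergence gives a local power series. The radius
  \<open>\<epsilon> - \<bar>Re z\<bar>\<close> keeps the real exponents of the dominating function
  inside the interval of integrability.\<close>

lemma holomorphic_mgf:
  fixes \<mu> :: "real measure"
  assumes sets [measurable_cong]: "sets \<mu> = sets borel"
    and int: "\<And>s. \<bar>s\<bar> < \<epsilon> \<Longrightarrow> integrable \<mu> (\<lambda>x. exp (s * x))"
  shows "(\<lambda>z. \<integral>x. exp (z * complex_of_real x) \<partial>\<mu>) holomorphic_on {z. \<bar>Re z\<bar> < \<epsilon>}"
proof -
  let ?F = "\<lambda>z. \<integral>x. exp (z * complex_of_real x) \<partial>\<mu>"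
  have "?F holomorphic_on ball z (\<epsilon> - \<bar>Re z\<bar>)" if z: "\<bar>Re z\<bar> < \<epsilon>" for z
  proof (rule power_series_holomorphic)
    fix w assume "w \<in> ball z (\<epsilon> - \<bar>Re z\<bar>)"
    then have w: "norm (w - z) < \<epsilon> - \<bar>Re z\<bar>"
      by (simp add: dist_norm norm_minus_commute)
    define a where "a = (\<lambda>n. \<integral>x. exp (z * complex_of_real x) * complex_of_real x ^ n / fact n \<partial>\<mu>)"
    define t where "t = (\<lambda>n x. exp (z * complex_of_real x) * (complex_of_real x * (w - z)) ^ n / fact n)"
    \<comment> \<open>A majorant of \<open>exp (Re z * x + \<bar>x\<bar> * norm (w - z))\<close>:
      the first summand is this value for nonnegative \<open>x\<close>, the second for negative
      \<open>x\<close>.\<close>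
    define g where "g = (\<lambda>x. exp ((Re z + norm (w - z)) * x) + exp ((Re z - norm (w - z)) * x))"
    have "\<bar>Re z + norm (w - z)\<bar> < \<epsilon>" "\<bar>Re z - norm (w - z)\<bar> < \<epsilon>"
      using w norm_ge_zero[of "w - z"] by linarith+
    then have g_int: "integrable \<mu> g"
      unfolding g_def by (intro Bochner_Integration.integrable_add int)
    have t_sums: "(\<lambda>n. t n x) sums exp (w * complex_of_real x)" for x
    proof -
      have "(\<lambda>n. exp (z * complex_of_real x) * ((complex_of_real x * (w - z)) ^ n /\<^sub>R fact n))
          sums (exp (z * complex_of_real x) * exp (complex_of_real x * (w - z)))"
        by (rule sums_mult[OF exp_converges])
      moreover have "exp (z * complex_of_real x) * exp (complex_of_real x * (w - z)) = exp (w * complex_of_real x)"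
        by (simp add: exp_add [symmetric] algebra_simps)
      moreover have "exp (z * complex_of_real x) * ((complex_of_real x * (w - z)) ^ n /\<^sub>R fact n) = t n x" for n
        by (simp add: t_def scaleR_conv_of_real divide_inverse)
      ultimately show ?thesis
        by simp
    qed
    have t_bound: "norm (\<Sum>n<N. t n x) \<le> g x" for N x
    proof -
      have "norm (\<Sum>n<N. t n x) \<le> (\<Sum>n<N. norm (t n x))"
        by (rule norm_sum)
      also have "\<dots> = exp (Re z * x) * (\<Sum>n<N. (\<bar>x\<bar> * norm (w - z)) ^ n /\<^sub>R fact n)"
        by (simp add: t_def sum_distrib_left norm_mult norm_divide norm_power norm_exp_times_of_real norm_inverse divide_inverse mult_ac)
      also have "\<dots> \<le> exp (Re z * x) * exp (\<bar>x\<bar> * norm (w - z))"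
        using exp_converges[of "\<bar>x\<bar> * norm (w - z)"]
        by (intro mult_left_mono sum_le_suminf[of _ "{..<N}", THEN order_trans]) (auto simp: sums_iff)
      also have "\<dots> \<le> g x"
        by (cases "x \<ge> 0") (simp_all add: g_def exp_add [symmetric] algebra_simps)
      finally show ?thesis .
    qed
    have t_int: "integrable \<mu> (t n)" for n
    proof (rule Bochner_Integration.integrable_bound[where f = "\<lambda>x. g x + g x"])
      show "integrable \<mu> (\<lambda>x. g x + g x)" using g_int by simp
      show "t n \<in> borel_measurable \<mu>" unfolding t_def by measurable
      \<comment> \<open>A single term is the difference of two consecutive partial sums, each
        bounded by \<open>g\<close>.\<close>
      have "norm (t n x) \<le> norm (g x + g x)" for x
      proof -
        have "norm (t n x) = norm ((\<Sum>k<Suc n. t k x) - (\<Sum>k<n. t k x))" by simp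
        also have "\<dots> \<le> norm (\<Sum>k<Suc n. t k x) + norm (\<Sum>k<n. t k x)"
          by (rule norm_triangle_ineq4)
        also have "\<dots> \<le> g x + g x" by (intro add_mono t_bound)
        finally show ?thesis by simp
      qed
      then show "AE x in \<mu>. norm (t n x) \<le> norm (g x + g x)" by simp
    qed
    have "(\<lambda>N. \<integral>x. (\<Sum>n<N. t n x) \<partial>\<mu>) \<longlonglongrightarrow> ?F w"
    proof (rule integral_dominated_convergence[where w = g])
      show "AE x in \<mu>. (\<lambda>N. \<Sum>n<N. t n x) \<longlonglongrightarrow> exp (w * complex_of_real x)"
        using t_sums by (simp add: sums_def)
      show "(\<lambda>x. \<Sum>n<N. t n x) \<in> borel_measurable \<mu>" for N unfolding t_def by measurable
    qed (use g_int t_bound in auto)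
    then have "(\<lambda>N. \<Sum>n<N. \<integral>x. t n x \<partial>\<mu>) \<longlonglongrightarrow> ?F w"
      using t_int by simp
    moreover have "(\<integral>x. t n x \<partial>\<mu>) = a n * (w - z) ^ n" for n
    proof -
      have "t n = (\<lambda>x. exp (z * complex_of_real x) * complex_of_real x ^ n / fact n * (w - z) ^ n)"
        by (auto simp: t_def power_mult_distrib)
      then show ?thesis
        by (simp add: a_def)
    qed
    ultimately show "(\<lambda>n. a n * (w - z) ^ n) sums ?F w"
      by (simp add: sums_def)
  qed
  then have "?F field_differentiable at z" if "\<bar>Re z\<bar> < \<epsilon>" for z
    using that by (auto intro!: holomorphic_on_imp_differentiable_at[of _ "ball z (\<epsilon> - \<bar>Re z\<bar>)"])
  then show ?thesis
    by (auto simp: holomorphic_on_def intro: field_differentiable_at_within)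
qed

text \<open>Both transforms extend holomorphically to the strip of all \<open>z\<close> with
  \<open>\<bar>Re z\<bar> < \<epsilon>\<close>. They agree on a real segment, hence by the identity
  theorem on the imaginary axis, where they are the characteristic functions.\<close>

lemma mgf_unique:
  fixes \<mu> \<nu> :: "real measure"
  assumes "real_distribution \<mu>" "real_distribution \<nu>" "0 < \<epsilon>"
    and \<mu>: "\<And>s. \<bar>s\<bar> < \<epsilon> \<Longrightarrow> has_bochner_integral \<mu> (\<lambda>x. exp (s * x)) (f s)"
    and \<nu>: "\<And>s. \<bar>s\<bar> < \<epsilon> \<Longrightarrow> has_bochner_integral \<nu> (\<lambda>x. exp (s * x)) (f s)"
  shows "\<mu> = \<nu>"
proof -
  interpret \<mu>: real_distribution \<mu> by fact
  interpret \<nu>: real_distribution \<nu> by fact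
  let ?F = "\<lambda>\<mu> z. \<integral>x. exp (z * complex_of_real x) \<partial>\<mu>"
  let ?S = "{z. \<bar>Re z\<bar> < \<epsilon>}"
  have hol: "(\<lambda>z. ?F \<mu> z - ?F \<nu> z) holomorphic_on ?S"
    using \<mu> \<nu> by (intro holomorphic_on_diff holomorphic_mgf) (auto simp: has_bochner_integral_iff)
  have S: "?S = {z. Re z < \<epsilon>} \<inter> {z. Re z > - \<epsilon>}" by auto
  have "open ?S" and "connected ?S"
    unfolding S by (auto intro!: open_Int open_halfspace_Re_lt open_halfspace_Re_gt convex_connected convex_Int
      convex_halfspace_Re_lt convex_halfspace_Re_gt)
  have islimpt: "0 islimpt complex_of_real ` {-\<epsilon><..<\<epsilon>}"
    unfolding islimpt_approachable
  proof (intro allI impI)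
    fix e :: real assume "0 < e"
    define s where "s = min e \<epsilon> / 2"
    have "0 < s" "s < e" "s < \<epsilon>"
      using \<open>0 < e\<close> \<open>0 < \<epsilon>\<close> by (auto simp: s_def)
    then show "\<exists>x'\<in>complex_of_real ` {- \<epsilon><..<\<epsilon>}. x' \<noteq> 0 \<and> dist x' 0 < e"
      by (intro bexI[of _ "complex_of_real s"] imageI) auto
  qed
  have real_axis: "?F \<mu> z - ?F \<nu> z = 0" if "z \<in> complex_of_real ` {-\<epsilon><..<\<epsilon>}" for z
  proof -
    obtain s where "z = complex_of_real s" "\<bar>s\<bar> < \<epsilon>" using \<open>z \<in> _\<close> by auto
    moreover from \<mu>[OF this(2)] \<nu>[OF this(2)]
    have "(\<integral>x. complex_of_real (exp (s * x)) \<partial>\<mu>) = (\<integral>x. complex_of_real (exp (s * x)) \<partial>\<nu>)"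
      by (simp add: has_bochner_integral_iff)
    ultimately show ?thesis
      by (simp flip: exp_of_real of_real_mult)
  qed
  have "?F \<mu> (\<i> * of_real t) - ?F \<nu> (\<i> * of_real t) = 0" for t
    by (rule analytic_continuation[OF hol \<open>open ?S\<close> \<open>connected ?S\<close> _ _ islimpt real_axis])
      (use \<open>0 < \<epsilon>\<close> in auto)
  then have "char \<mu> = char \<nu>"
    by (auto simp: char_def fun_eq_iff mult.assoc)
  with assms(1,2) show ?thesis by (rule Levy_uniqueness)
qed

text \<open>Here \<open>c n\<close> is the n-th moment divided by \<open>fact n\<close>. The
  geometric bound makes the series of the \<open>c n * s ^ n\<close> converge near 0, and its sum is
  the moment generating function of either law, so \<open>mgf_unique\<close> applies.\<close>

lemma moments_unique:
  fixes \<mu> \<nu> :: "real measure" and c :: "nat \<Rightarrow> real"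
  assumes "real_distribution \<mu>" "real_distribution \<nu>"
    and nonneg: "AE x in \<mu>. 0 \<le> x" "AE x in \<nu>. 0 \<le> x"
    and c: "\<And>n. c n \<le> C ^ n"
    and moments: "\<And>n. has_bochner_integral \<mu> (\<lambda>x. x ^ n / fact n) (c n)"
      "\<And>n. has_bochner_integral \<nu> (\<lambda>x. x ^ n / fact n) (c n)"
  shows "\<mu> = \<nu>"
proof -
  \<comment> \<open>This forces \<open>\<bar>C\<bar> * \<bar>s\<bar> < 1\<close> whenever
    \<open>\<bar>s\<bar> < \<epsilon>\<close>; the added 1 covers \<open>C = 0\<close>.\<close>
  define \<epsilon> where "\<epsilon> = 1 / (\<bar>C\<bar> + 1)"
  have c': "c n \<le> \<bar>C\<bar> ^ n" for n using c[of n] by (metis order_trans abs_ge_self power_abs)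
  have mgf: "has_bochner_integral M (\<lambda>x. exp (s * x)) (\<Sum>n. c n * s ^ n)"
    if [measurable_cong]: "sets M = sets borel" and M: "AE x in M. 0 \<le> x" "\<And>n. has_bochner_integral M (\<lambda>x. x ^ n / fact n) (c n)" and s: "\<bar>s\<bar> < \<epsilon>"
    for M :: "real measure" and s
  proof -
    have "c n \<ge> 0" for n
    proof -
      have "AE x in M. 0 \<le> x ^ n / fact n"
        using M(1) by eventually_elim simp
      from integral_nonneg_AE[OF this] show ?thesis
        using M(2)[of n] by (auto simp: has_bochner_integral_iff)
    qed
    define t where "t = (\<lambda>n (x::real). x ^ n / fact n * s ^ n)"
    have t: "has_bochner_integral M (t n) (c n * s ^ n)" for n
      unfolding t_def using M(2) by (rule has_bochner_integral_mult_left)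
    \<comment> \<open>On the half line absolute moments are moments, so the bound on
      \<open>c\<close> also controls the norms needed to exchange sum and integral.\<close>
    have norm_t: "(\<integral>x. norm (t n x) \<partial>M) = c n * \<bar>s\<bar> ^ n" for n
    proof -
      have "(\<integral>x. norm (t n x) \<partial>M) = (\<integral>x. x ^ n / fact n * \<bar>s\<bar> ^ n \<partial>M)"
      proof (rule integral_cong_AE)
        show "AE x in M. norm (t n x) = x ^ n / fact n * \<bar>s\<bar> ^ n"
          using M(1) by eventually_elim (simp add: t_def abs_mult power_abs)
      qed (simp_all add: t_def)
      also have "\<dots> = c n * \<bar>s\<bar> ^ n"
        using has_bochner_integral_mult_left[OF M(2)[of n], of "\<bar>s\<bar> ^ n"]
        by (simp only: has_bochner_integral_iff)
      finally show ?thesis .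
    qed
    have t_sums: "(\<lambda>n. t n x) sums exp (s * x)" for x
      using exp_converges[of "s * x"] by (simp add: t_def power_mult_distrib field_simps)
    have summable: "summable (\<lambda>n. \<integral>x. norm (t n x) \<partial>M)"
    proof (rule summable_comparison_test')
      have "\<bar>C\<bar> * \<bar>s\<bar> \<le> \<bar>C\<bar> * \<epsilon>" using s by (intro mult_left_mono) auto
      also have "\<dots> < 1" by (simp add: \<epsilon>_def field_simps)
      finally show "summable (\<lambda>n. (\<bar>C\<bar> * \<bar>s\<bar>) ^ n)" by (intro summable_geometric) simp
      show "norm (\<integral>x. norm (t n x) \<partial>M) \<le> (\<bar>C\<bar> * \<bar>s\<bar>) ^ n" for n
        unfolding norm_t using \<open>c n \<ge> 0\<close> c'[of n]
        by (simp add: power_mult_distrib abs_mult power_abs mult_right_mono)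
    qed
    have AE_summable: "AE x in M. summable (\<lambda>n. norm (t n x))"
    proof (rule AE_I2)
      fix x
      show "summable (\<lambda>n. norm (t n x))"
        using exp_converges[of "\<bar>s * x\<bar>"]
        by (simp add: t_def abs_mult power_abs power_mult_distrib sums_iff field_simps)
    qed
    have t_int: "integrable M (t n)" and t_lint: "integral\<^sup>L M (t n) = c n * s ^ n" for n
      using t[of n] by (auto simp: has_bochner_integral_iff)
    have t_suminf: "(\<lambda>x. \<Sum>n. t n x) = (\<lambda>x. exp (s * x))"
      using t_sums by (simp add: sums_iff)
    have "integrable M (\<lambda>x. exp (s * x))"
      using integrable_suminf[OF t_int AE_summable summable] by (simp only: t_suminf)
    moreover have "(\<lambda>n. c n * s ^ n) sums (\<integral>x. exp (s * x) \<partial>M)"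
      using sums_integral[OF t_int AE_summable summable] by (simp only: t_suminf t_lint)
    ultimately show ?thesis by (simp add: has_bochner_integral_iff sums_iff)
  qed
  interpret \<mu>: real_distribution \<mu> by fact
  interpret \<nu>: real_distribution \<nu> by fact
  show ?thesis
  proof (rule mgf_unique[OF assms(1,2)])
    show "0 < \<epsilon>" by (simp add: \<epsilon>_def)
    show "has_bochner_integral \<mu> (\<lambda>x. exp (s * x)) (\<Sum>n. c n * s ^ n)" if "\<bar>s\<bar> < \<epsilon>" for s
      by (rule mgf[OF \<mu>.events_eq_borel nonneg(1) moments(1) that])
    show "has_bochner_integral \<nu> (\<lambda>x. exp (s * x)) (\<Sum>n. c n * s ^ n)" if "\<bar>s\<bar> < \<epsilon>" for s
      by (rule mgf[OF \<nu>.events_eq_borel nonneg(2) moments(2) that])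
  qed
qed

subsection \<open>Dufresne laws\<close>

lemma real_distributionI: "prob_space M \<Longrightarrow> sets M = sets borel \<Longrightarrow> real_distribution M"
  by (simp add: real_distribution_def real_distribution_axioms_def)

lemma gamma_quotient_Nil [simp]: "gamma_quotient [] s = 1"
  and gamma_quotient_Cons [simp]: "gamma_quotient (a # as) s = Gamma (a + s) / Gamma a * gamma_quotient as s"
  by (simp_all add: gamma_quotient_def)

lemma gamma_quotient_append: "gamma_quotient (as @ bs) s = gamma_quotient as s * gamma_quotient bs s"
  by (induction as) simp_all

lemma Gamma_real_nonzero: "0 < a \<Longrightarrow> Gamma a \<noteq> (0 :: real)"
  using Gamma_real_pos by (metis less_irrefl)

lemma gamma_quotient_0: "(\<forall>a\<in>set as. 0 < a) \<Longrightarrow> gamma_quotient as 0 = 1"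
  by (induction as) (auto simp: Gamma_real_nonzero)

lemma is_dufresne_law_real_distribution: "is_dufresne_law as bs D \<Longrightarrow> real_distribution D"
  by (simp add: is_dufresne_law_def real_distributionI)

text \<open>Under the map \<open>ln\<close> the Mellin transform becomes a moment generating
  function, prescribed near 0 because all parameters are positive. So \<open>mgf_unique\<close>
  identifies the images, and \<open>exp\<close> maps them back.\<close>

lemma is_dufresne_law_unique:
  assumes D: "is_dufresne_law as bs D" and E: "is_dufresne_law as bs E"
  shows "D = E"
proof -
  have pos: "\<forall>a\<in>set (as @ bs). 0 < a"
    using D by (auto simp: is_dufresne_law_def)
  \<comment> \<open>The inserted 1 keeps the set nonempty when both lists are empty.\<close>
  define \<epsilon> where "\<epsilon> = Min (insert 1 (set (as @ bs)))"
  have "0 < \<epsilon>"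
    using pos by (auto simp: \<epsilon>_def)
  have s: "0 < a + s" if "\<bar>s\<bar> < \<epsilon>" "a \<in> set (as @ bs)" for a s
  proof -
    have "\<epsilon> \<le> a" unfolding \<epsilon>_def using that by (intro Min_le) auto
    with that show ?thesis by linarith
  qed
  have mgf: "real_distribution (distr M borel ln)"
    "\<bar>s\<bar> < \<epsilon> \<Longrightarrow> has_bochner_integral (distr M borel ln) (\<lambda>x. exp (s * x)) (gamma_quotient as s / gamma_quotient bs s)"
    "distr (distr M borel ln) borel exp = M"
    if M: "is_dufresne_law as bs M" for M :: "real measure" and s
  proof -
    interpret real_distribution M using M by (rule is_dufresne_law_real_distribution)
    have [measurable_cong]: "sets M = sets borel" by simp
    show "real_distribution (distr M borel ln)"
      by (intro real_distributionI prob_space_distr) simp_all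
    have AE: "AE x in M. 0 < x"
      using M by (simp add: is_dufresne_law_def)
    show "has_bochner_integral (distr M borel ln) (\<lambda>x. exp (s * x)) (gamma_quotient as s / gamma_quotient bs s)" if "\<bar>s\<bar> < \<epsilon>"
    proof (rule has_bochner_integral_distr)
      have "has_bochner_integral M (\<lambda>x. x powr s) (gamma_quotient as s / gamma_quotient bs s)"
        using M s[OF that] by (simp add: is_dufresne_law_def)
      moreover have "AE x in M. x powr s = exp (s * ln x)"
        using AE by eventually_elim (simp add: powr_def)
      ultimately show "has_bochner_integral M (\<lambda>x. exp (s * ln x)) (gamma_quotient as s / gamma_quotient bs s)"
        by (subst (asm) has_bochner_integral_cong_AE) auto
    qed simp_all
    \<comment> \<open>\<open>exp\<close> undoes \<open>ln\<close> only on positive numbers, which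
      carry \<open>M\<close>.\<close>
    have "distr (distr M borel ln) borel exp = distr M borel (exp \<circ> ln)"
      by (rule distr_distr) simp_all
    also have "\<dots> = distr M M (\<lambda>x. x)"
    proof (rule distr_cong_AE)
      show "AE x in M. (exp \<circ> ln) x = x"
        using AE by eventually_elim simp
    qed simp_all
    finally show "distr (distr M borel ln) borel exp = M"
      by simp
  qed
  have "distr D borel ln = distr E borel ln"
    by (rule mgf_unique[OF mgf(1)[OF D] mgf(1)[OF E] \<open>0 < \<epsilon>\<close> mgf(2)[OF D] mgf(2)[OF E]])
  then show ?thesis
    by (metis mgf(3)[OF D] mgf(3)[OF E])
qed

lemma dufresne_eqI: "is_dufresne_law as bs D \<Longrightarrow> dufresne as bs = D"
  unfolding dufresne_def by (rule the_equality) (auto intro: is_dufresne_law_unique)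

section \<open>Gamma and beta laws from their densities\<close>

lemma is_dufresne_law_density:
  fixes f :: "real \<Rightarrow> real"
  assumes [measurable]: "f \<in> borel_measurable borel" and "\<And>x. 0 \<le> f x" and f_0: "\<And>x. x \<le> 0 \<Longrightarrow> f x = 0"
    and pos: "\<forall>a\<in>set as. 0 < a" "\<forall>b\<in>set bs. 0 < b"
    and mellin: "\<And>s. (\<forall>a\<in>set as. 0 < a + s) \<Longrightarrow> (\<forall>b\<in>set bs. 0 < b + s) \<Longrightarrow>
      ((\<lambda>x. f x * x powr s) has_integral gamma_quotient as s / gamma_quotient bs s) UNIV"
  shows "is_dufresne_law as bs (density lborel f)"
proof -
  have int: "has_bochner_integral lborel (\<lambda>x. f x * x powr s) (gamma_quotient as s / gamma_quotient bs s)"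
    if s: "\<forall>a\<in>set as. 0 < a + s" "\<forall>b\<in>set bs. 0 < b + s" for s
  \<comment> \<open>Nonnegativity of the integrand turns the gauge integral of \<open>mellin\<close>
    into a Lebesgue integral.\<close>
  proof (rule has_bochner_integral_nn_integral)
    show "0 \<le> gamma_quotient as s / gamma_quotient bs s"
      using mellin[OF s] by (rule has_integral_nonneg) (simp add: assms)
    show "(\<integral>\<^sup>+x. ennreal (f x * x powr s) \<partial>lborel) = ennreal (gamma_quotient as s / gamma_quotient bs s)"
      by (rule nn_integral_has_integral_lborel) (use assms mellin[OF s] in auto)
  qed (use assms in auto)
  \<comment> \<open>Taking \<open>s = 0\<close> in the transform gives total mass 1. At the origin
    \<open>0 powr 0\<close> is 0, which agrees with \<open>f 0 = 0\<close>.\<close>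
  have "(\<lambda>x. f x * x powr 0) = f"
    using f_0[of 0] by (auto simp: fun_eq_iff)
  with int[of 0] pos have "has_bochner_integral lborel f 1"
    by (simp only: gamma_quotient_0 add_0_right div_by_1 simp_thms)
  then have "(\<integral>\<^sup>+x. ennreal (f x) \<partial>lborel) = ennreal 1"
    using assms(2) by (subst nn_integral_eq_integral) (auto simp: has_bochner_integral_iff)
  then have "prob_space (density lborel f)"
    by (intro prob_spaceI) (simp add: emeasure_density)
  moreover have "AE x in density lborel f. 0 < x"
  proof (subst AE_density)
    show "AE x in lborel. 0 < ennreal (f x) \<longrightarrow> 0 < x"
      using f_0 by (intro AE_I2) (metis ennreal_0 less_irrefl not_le)
  qed simp
  moreover have "has_bochner_integral (density lborel f) (\<lambda>x. x powr s) (gamma_quotient as s / gamma_quotient bs s)"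
    if "\<forall>a\<in>set as. 0 < a + s" "\<forall>b\<in>set bs. 0 < b + s" for s
    by (rule has_bochner_integral_density) (use int[OF that] assms(2) in auto)
  ultimately show ?thesis
    using pos by (simp add: is_dufresne_law_def)
qed

lemma is_dufresne_law_gamma:
  fixes c :: real
  assumes "0 < c"
  shows "is_dufresne_law [c] [] (density lborel (\<lambda>x. indicator {0<..} x * (x powr (c - 1) / exp x) / Gamma c))"
proof (rule is_dufresne_law_density)
  fix s assume "\<forall>a\<in>set [c]. 0 < a + s"
  then have "((\<lambda>x. x powr (c + s - 1) / exp x / Gamma c) has_integral Gamma (c + s) / Gamma c) {0..}"
    by (intro has_integral_divide Gamma_integral_real) simp
  then have "((\<lambda>x. if x \<in> {0..} then x powr (c + s - 1) / exp x / Gamma c else 0) has_integral Gamma (c + s) / Gamma c) UNIV"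
    by (simp only: has_integral_restrict_UNIV)
  also have "(\<lambda>x. if x \<in> {0..} then x powr (c + s - 1) / exp x / Gamma c else 0) =
      (\<lambda>x. indicator {0<..} x * (x powr (c - 1) / exp x) / Gamma c * x powr s)"
    by (auto simp: fun_eq_iff indicator_def simp flip: powr_add) (simp add: algebra_simps)
  finally show "((\<lambda>x. indicator {0<..} x * (x powr (c - 1) / exp x) / Gamma c * x powr s)
      has_integral gamma_quotient [c] s / gamma_quotient [] s) UNIV"
    by simp
qed (use assms in \<open>auto simp: indicator_def\<close>)

text \<open>The Mellin integral is \<open>Beta (a + s) b / Beta a b\<close>, in which
  \<open>Gamma b\<close> cancels. The density vanishes at the endpoint 1, since
  \<open>0 powr t\<close> is 0 for every \<open>t\<close>.\<close>

lemma is_dufresne_law_beta: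
  fixes a b :: real
  assumes "0 < a" "0 < b"
  shows "is_dufresne_law [a] [a + b]
    (density lborel (\<lambda>x. indicator {0<..1} x * (x powr (a - 1) * (1 - x) powr (b - 1)) / Beta a b))"
proof (rule is_dufresne_law_density)
  fix s assume s: "\<forall>x\<in>set [a]. 0 < x + s"
  then have "((\<lambda>x. x powr (a + s - 1) * (1 - x) powr (b - 1) / Beta a b) has_integral Beta (a + s) b / Beta a b) {0..1}"
    using assms by (intro has_integral_divide has_integral_Beta_real) simp_all
  then have "((\<lambda>x. if x \<in> {0..1} then x powr (a + s - 1) * (1 - x) powr (b - 1) / Beta a b else 0)
      has_integral Beta (a + s) b / Beta a b) UNIV"
    by (simp only: has_integral_restrict_UNIV)
  also have "(\<lambda>x. if x \<in> {0..1} then x powr (a + s - 1) * (1 - x) powr (b - 1) / Beta a b else 0) =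
      (\<lambda>x. indicator {0<..1} x * (x powr (a - 1) * (1 - x) powr (b - 1)) / Beta a b * x powr s)"
    by (auto simp: fun_eq_iff indicator_def powr_add [symmetric] algebra_simps)
  also have "Beta (a + s) b / Beta a b = gamma_quotient [a] s / gamma_quotient [a + b] s"
    using assms s by (simp add: Beta_def Gamma_real_nonzero add_ac)
  finally show "((\<lambda>x. indicator {0<..1} x * (x powr (a - 1) * (1 - x) powr (b - 1)) / Beta a b * x powr s)
      has_integral gamma_quotient [a] s / gamma_quotient [a + b] s) UNIV" .
qed (use assms in \<open>auto simp: indicator_def Beta_def\<close>)

section \<open>Sums and products of independent real variables, at the level of laws\<close>

definition mult_convolution :: "real measure \<Rightarrow> real measure \<Rightarrow> real measure" where
  "mult_convolution M N = distr (M \<Otimes>\<^sub>M N) borel (\<lambda>(x, y). x * y)"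

lemma sets_mult_convolution [simp, measurable_cong]: "sets (mult_convolution M N) = sets borel"
  by (simp add: mult_convolution_def)

locale pair_real_distribution = M: real_distribution M + N: real_distribution N for M N
begin

sublocale pair_prob_space M N ..

lemma sets_pair: "sets (M \<Otimes>\<^sub>M N) = sets (borel \<Otimes>\<^sub>M borel)"
  by (rule sets_pair_measure_cong) simp_all

lemma measurable_pair [simp]: "measurable (M \<Otimes>\<^sub>M N) = measurable (borel \<Otimes>\<^sub>M borel)"
  by (intro ext measurable_cong_sets sets_pair refl)

lemma real_distribution_convolution: "real_distribution (convolution M N)"
  unfolding convolution_def by (intro real_distributionI prob_space_distr) simp_all

lemma real_distribution_mult_convolution: "real_distribution (mult_convolution M N)"
  unfolding mult_convolution_def by (intro real_distributionI prob_space_distr) simp_all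

lemma AE_pair_distribution:
  assumes "AE x in M. P x" "AE y in N. Q y" and [measurable]: "Measurable.pred borel P" "Measurable.pred borel Q"
  shows "AE z in M \<Otimes>\<^sub>M N. P (fst z) \<and> Q (snd z)"
proof (rule AE_pair_measure)
  show "{x \<in> space (M \<Otimes>\<^sub>M N). P (fst x) \<and> Q (snd x)} \<in> sets (M \<Otimes>\<^sub>M N)"
    unfolding sets_pair sets_eq_imp_space_eq[OF sets_pair] by measurable
  show "AE x in M. AE y in N. P (fst (x, y)) \<and> Q (snd (x, y))"
    using assms(1)
  proof eventually_elim
    case (elim x)
    show ?case using assms(2) by eventually_elim (simp add: elim)
  qed
qed

lemma AE_convolution_pos:
  assumes "AE x in M. 0 < x" "AE y in N. 0 < y"
  shows "AE z in convolution M N. 0 < z"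
proof -
  have "AE z in M \<Otimes>\<^sub>M N. 0 < fst z \<and> 0 < snd z"
    by (intro AE_pair_distribution assms) simp_all
  then have "AE z in M \<Otimes>\<^sub>M N. 0 < (case z of (x, y) \<Rightarrow> x + y)"
    by eventually_elim (auto simp: split_beta)
  then show ?thesis
    unfolding convolution_def by (subst AE_distr_iff) simp_all
qed

lemma AE_mult_convolution_pos:
  assumes "AE x in M. 0 < x" "AE y in N. 0 < y"
  shows "AE z in mult_convolution M N. 0 < z"
proof -
  have "AE z in M \<Otimes>\<^sub>M N. 0 < fst z \<and> 0 < snd z"
    by (intro AE_pair_distribution assms) simp_all
  then have "AE z in M \<Otimes>\<^sub>M N. 0 < (case z of (x, y) \<Rightarrow> x * y)"
    by eventually_elim (auto simp: split_beta)
  then show ?thesis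
    unfolding mult_convolution_def by (subst AE_distr_iff) simp_all
qed

lemma has_bochner_integral_pair_mult:
  fixes f g :: "real \<Rightarrow> real"
  assumes "has_bochner_integral M f a" "has_bochner_integral N g b"
  shows "has_bochner_integral (M \<Otimes>\<^sub>M N) (\<lambda>z. f (fst z) * g (snd z)) (a * b)"
proof -
  have [measurable]: "f \<in> borel_measurable borel" "g \<in> borel_measurable borel"
    using assms[THEN borel_measurable_has_bochner_integral] by simp_all
  have int: "integrable M f" "integrable N g" "integral\<^sup>L M f = a" "integral\<^sup>L N g = b"
    using assms by (simp_all add: has_bochner_integral_iff)
  have pair_int: "integrable (M \<Otimes>\<^sub>M N) (\<lambda>z. f (fst z) * g (snd z))"
    using int by (intro Fubini_integrable) (auto simp: abs_mult)
  show ?thesis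
    using integral_fst'[OF pair_int] pair_int int by (simp add: has_bochner_integral_iff)
qed

text \<open>Fubini for integrands that split over a product. The splitting is asked only where
  \<open>P\<close> and \<open>Q\<close> hold: with both as positivity this serves real powers, with
  both as \<open>True\<close> it serves monomials.\<close>

lemma has_bochner_integral_mult_convolution:
  fixes f :: "real \<Rightarrow> real"
  assumes [measurable]: "f \<in> borel_measurable borel"
    and f_mult: "\<And>x y. P x \<Longrightarrow> Q y \<Longrightarrow> f (x * y) = g x * h y"
    and AE: "AE x in M. P x" "AE y in N. Q y"
    and [measurable]: "Measurable.pred borel P" "Measurable.pred borel Q"
    and int: "has_bochner_integral M g a" "has_bochner_integral N h b"
  shows "has_bochner_integral (mult_convolution M N) f (a * b)"
  unfolding mult_convolution_def
proof (rule has_bochner_integral_distr)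
  have [measurable]: "g \<in> borel_measurable borel" "h \<in> borel_measurable borel"
    using int[THEN borel_measurable_has_bochner_integral] by simp_all
  have "AE z in M \<Otimes>\<^sub>M N. P (fst z) \<and> Q (snd z)"
    by (intro AE_pair_distribution AE) simp_all
  then have "AE z in M \<Otimes>\<^sub>M N. f (case z of (x, y) \<Rightarrow> x * y) = g (fst z) * h (snd z)"
    by eventually_elim (simp add: split_beta f_mult)
  then show "has_bochner_integral (M \<Otimes>\<^sub>M N) (\<lambda>z. f (case z of (x, y) \<Rightarrow> x * y)) (a * b)"
    using has_bochner_integral_pair_mult[OF int] by (subst has_bochner_integral_cong_AE) auto
qed simp_all

lemma char_convolution: "char (convolution M N) t = char M t * char N t"
proof -
  have "char (convolution M N) t = (\<integral>z. iexp (t * (fst z + snd z)) \<partial>(M \<Otimes>\<^sub>M N))"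
    unfolding char_def convolution_def by (subst integral_distr) (auto simp: split_beta)
  also have "\<dots> = (\<integral>x. \<integral>y. iexp (t * (x + y)) \<partial>N \<partial>M)"
    by (subst integral_fst' [symmetric]) (auto intro!: integrable_const_bound[of _ 1])
  also have "\<dots> = (\<integral>x. iexp (t * x) * char N t \<partial>M)"
    by (simp add: char_def distrib_left exp_add)
  also have "\<dots> = char M t * char N t"
    by (simp add: char_def)
  finally show ?thesis .
qed

text \<open>Conditioning on the first factor: for fixed \<open>x\<close>, scaling a variable of law
  \<open>N\<close> by \<open>x\<close> scales the argument of its characteristic function.\<close>

lemma char_mult_convolution: "char (mult_convolution M N) t = (\<integral>x. char N (t * x) \<partial>M)"
proof -
  have "char (mult_convolution M N) t = (\<integral>z. iexp (t * (fst z * snd z)) \<partial>(M \<Otimes>\<^sub>M N))"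
    unfolding char_def mult_convolution_def by (subst integral_distr) (auto simp: split_beta)
  also have "\<dots> = (\<integral>x. \<integral>y. iexp (t * (x * y)) \<partial>N \<partial>M)"
    by (subst integral_fst' [symmetric]) (auto intro!: integrable_const_bound[of _ 1])
  finally show ?thesis
    by (simp add: char_def mult.assoc)
qed

end

text \<open>Mellin transforms of independent factors multiply. This builds the laws with several
  parameters out of beta and gamma laws.\<close>

lemma is_dufresne_law_mult_convolution:
  assumes D: "is_dufresne_law as bs D" and E: "is_dufresne_law as' bs' E"
  shows "is_dufresne_law (as @ as') (bs @ bs') (mult_convolution D E)"
proof -
  interpret pair_real_distribution D E
    using D E by (simp add: pair_real_distribution_def is_dufresne_law_real_distribution)
  have AE: "AE x in D. 0 < x" "AE x in E. 0 < x"
    using D E by (simp_all add: is_dufresne_law_def)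
  have "has_bochner_integral (mult_convolution D E) (\<lambda>x. x powr s)
      (gamma_quotient as s / gamma_quotient bs s * (gamma_quotient as' s / gamma_quotient bs' s))"
    if "\<forall>a\<in>set (as @ as'). 0 < a + s" "\<forall>b\<in>set (bs @ bs'). 0 < b + s" for s
  proof (rule has_bochner_integral_mult_convolution[where P = "\<lambda>x. 0 < x" and Q = "\<lambda>x. 0 < x"])
    show "(x * y) powr s = x powr s * y powr s" if "0 < x" "0 < y" for x y :: real
      using that by (simp add: powr_mult)
  qed (use D E AE that in \<open>auto simp: is_dufresne_law_def\<close>)
  then show ?thesis
    using D E real_distribution_mult_convolution AE_mult_convolution_pos[OF AE]
    by (auto simp: is_dufresne_law_def gamma_quotient_append real_distribution_def)
qed

subsection \<open>Moments and fixed points\<close>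

text \<open>\<open>f\<close> is the exponential generating function of the moments, kept formal so
  that no convergence is involved. Division by \<open>fact n\<close> turns the binomial theorem into
  the Cauchy product, so convolution of laws becomes multiplication of series.\<close>

definition has_moment_fps :: "real measure \<Rightarrow> real fps \<Rightarrow> bool" where
  "has_moment_fps M f \<longleftrightarrow> (\<forall>n. has_bochner_integral M (\<lambda>x. x ^ n / fact n) (fps_nth f n))"

context pair_real_distribution
begin

lemma has_moment_fps_convolution:
  assumes "has_moment_fps M f" "has_moment_fps N g"
  shows "has_moment_fps (convolution M N) (f * g)"
  unfolding has_moment_fps_def
proof
  fix n
  have "has_bochner_integral (M \<Otimes>\<^sub>M N) (\<lambda>z. \<Sum>i=0..n. fst z ^ i / fact i * (snd z ^ (n - i) / fact (n - i)))
      (fps_nth (f * g) n)"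
    unfolding fps_mult_nth using assms
    by (intro has_bochner_integral_sum has_bochner_integral_pair_mult) (auto simp: has_moment_fps_def)
  moreover have "(x + y) ^ n / fact n = (\<Sum>i=0..n. x ^ i / fact i * (y ^ (n - i) / fact (n - i)))" for x y :: real
    unfolding binomial_ring sum_divide_distrib atMost_atLeast0
    by (intro sum.cong) (auto simp: binomial_fact)
  ultimately show "has_bochner_integral (convolution M N) (\<lambda>x. x ^ n / fact n) (fps_nth (f * g) n)"
    unfolding convolution_def by (intro has_bochner_integral_distr) (auto simp: split_beta)
qed

end

text \<open>The Mellin transform at \<open>s = n\<close>: the quotient of
  \<open>Gamma (c + n)\<close> by \<open>Gamma c\<close> is \<open>pochhammer c n\<close>.\<close>

lemma is_dufresne_law_moments:
  assumes D: "is_dufresne_law as bs D"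
  shows "has_bochner_integral D (\<lambda>x. x ^ n) ((\<Prod>a\<leftarrow>as. pochhammer a n) / (\<Prod>b\<leftarrow>bs. pochhammer b n))"
proof -
  interpret real_distribution D using D by (rule is_dufresne_law_real_distribution)
  have gq: "gamma_quotient cs (real n) = (\<Prod>c\<leftarrow>cs. pochhammer c n)" if "\<forall>c\<in>set cs. 0 < c" for cs
    using that
  proof (induction cs)
    case (Cons c cs)
    then have "c \<notin> \<int>\<^sub>\<le>\<^sub>0" by (auto elim!: nonpos_Ints_cases)
    with Cons show ?case by (simp add: pochhammer_Gamma)
  qed simp
  have "has_bochner_integral D (\<lambda>x. x powr real n) (gamma_quotient as (real n) / gamma_quotient bs (real n))"
    using D unfolding is_dufresne_law_def by (meson add_pos_nonneg of_nat_0_le_iff)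
  moreover have "AE x in D. x powr real n = x ^ n"
  proof -
    have "AE x in D. 0 < x" using D by (simp add: is_dufresne_law_def)
    then show ?thesis by eventually_elim (rule powr_realpow)
  qed
  ultimately have "has_bochner_integral D (\<lambda>x. x ^ n) (gamma_quotient as (real n) / gamma_quotient bs (real n))"
    by (subst (asm) has_bochner_integral_cong_AE) auto
  then show ?thesis
    using D by (simp add: gq is_dufresne_law_def)
qed

text \<open>By Markov's inequality for the n-th power, the mass of \<open>{1..}\<close> is at most
  \<open>m n\<close> for every \<open>n\<close>.\<close>

lemma AE_less_1_if_moments_tendsto_0:
  assumes "real_distribution M" and nonneg: "AE x in M. 0 \<le> x"
    and m: "\<And>n. has_bochner_integral M (\<lambda>x. x ^ n) (m n)" "m \<longlonglongrightarrow> 0"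
  shows "AE x in M. x < 1"
proof -
  interpret real_distribution M by fact
  have le: "measure M {1..} \<le> m n" for n
  proof -
    have "measure M {1..} \<le> measure M {x \<in> space M. 1 \<le> x ^ n}"
      by (intro finite_measure_mono) auto
    also have "\<dots> \<le> (\<integral>x. x ^ n \<partial>M) / 1"
    proof (rule integral_Markov_inequality_measure[where A = "{}"])
      show "AE x in M. 0 \<le> x ^ n" using nonneg by eventually_elim simp
    qed (use m(1)[of n] in \<open>auto simp: has_bochner_integral_iff\<close>)
    finally show ?thesis using m(1)[of n] by (simp add: has_bochner_integral_iff)
  qed
  have "measure M {1..} \<le> 0"
    by (rule LIMSEQ_le_const[OF m(2)]) (use le in auto)
  then have "emeasure M {1..} = 0"
    using measure_nonneg[of M "{1..}"] by (simp add: emeasure_eq_measure)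
  then show ?thesis
    by (intro AE_I[of _ _ "{1..}"]) auto
qed

text \<open>Conditioning on \<open>A\<close> turns invariance into an averaging equation for
  characteristic functions. The factor \<open>char B\<close> has modulus at most 1, so it drops out
  of the estimate for the difference \<open>h\<close>, and a maximum argument finishes.\<close>

lemma perpetuity_law_unique:
  assumes "real_distribution A" "real_distribution B" "real_distribution \<mu>" "real_distribution \<nu>"
    and A: "AE x in A. 0 < x" "AE x in A. x < 1"
    and \<mu>: "\<mu> = mult_convolution A (convolution \<mu> B)"
    and \<nu>: "\<nu> = mult_convolution A (convolution \<nu> B)"
  shows "\<mu> = \<nu>"
proof -
  interpret A: real_distribution A by fact
  interpret B: real_distribution B by fact
  interpret \<mu>: real_distribution \<mu> by fact
  interpret \<nu>: real_distribution \<nu> by fact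
  define h where "h = (\<lambda>t. norm (char \<mu> t - char \<nu> t))"
  have h_cont: "continuous_on UNIV h"
    unfolding h_def by (intro continuous_intros continuous_at_imp_continuous_on ballI \<mu>.isCont_char \<nu>.isCont_char)
  then have [measurable]: "h \<in> borel_measurable borel"
    by (rule borel_measurable_continuous_onI)
  have h_0: "h 0 = 0"
    by (simp add: h_def \<mu>.char_zero \<nu>.char_zero)
  have h_nonneg: "0 \<le> h t" and h_le_2: "h t \<le> 2" for t
    using norm_triangle_ineq4[of "char \<mu> t" "char \<nu> t"] \<mu>.cmod_char_le_1[of t] \<nu>.cmod_char_le_1[of t]
    by (auto simp: h_def)
  have h_int: "integrable A (\<lambda>x. h (t * x))" for t
    using h_nonneg h_le_2 by (intro A.integrable_const_bound[of _ 2]) auto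
  have char_eq: "char \<xi> t = (\<integral>x. char \<xi> (t * x) * char B (t * x) \<partial>A)"
    if "real_distribution \<xi>" "\<xi> = mult_convolution A (convolution \<xi> B)" for \<xi> t
  proof -
    interpret \<xi>B: pair_real_distribution \<xi> B
      using that(1) by (simp add: pair_real_distribution_def assms(1,2))
    interpret A\<xi>B: pair_real_distribution A "convolution \<xi> B"
      using \<xi>B.real_distribution_convolution by (simp add: pair_real_distribution_def assms(1,2))
    show ?thesis
      by (subst that(2)) (simp add: A\<xi>B.char_mult_convolution \<xi>B.char_convolution)
  qed
  have char_int: "integrable A (\<lambda>x. char \<xi> (t * x) * char B (t * x))" if "real_distribution \<xi>" for \<xi> t
  proof -
    interpret \<xi>: real_distribution \<xi> by fact
    show ?thesis
      using \<xi>.cmod_char_le_1 B.cmod_char_le_1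
      by (intro A.integrable_const_bound[of _ 1]) (auto simp: norm_mult intro!: mult_le_one)
  qed
  have h_le: "h t \<le> (\<integral>x. h (t * x) \<partial>A)" for t
  proof -
    have "h t = norm (\<integral>x. char \<mu> (t * x) * char B (t * x) - char \<nu> (t * x) * char B (t * x) \<partial>A)"
      unfolding h_def
      by (subst char_eq[OF assms(3) \<mu>], subst char_eq[OF assms(4) \<nu>])
        (simp add: char_int assms(3,4))
    also have "\<dots> \<le> (\<integral>x. norm (char \<mu> (t * x) * char B (t * x) - char \<nu> (t * x) * char B (t * x)) \<partial>A)"
      by (rule integral_norm_bound)
    also have "\<dots> \<le> (\<integral>x. h (t * x) \<partial>A)"
    proof (rule integral_mono)
      show "integrable A (\<lambda>x. norm (char \<mu> (t * x) * char B (t * x) - char \<nu> (t * x) * char B (t * x)))"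
        by (intro integrable_norm Bochner_Integration.integrable_diff char_int assms(3,4))
      show "norm (char \<mu> (t * x) * char B (t * x) - char \<nu> (t * x) * char B (t * x)) \<le> h (t * x)" for x
        using mult_left_mono[OF B.cmod_char_le_1[of "t * x"], of "h (t * x)"]
        by (simp add: h_def norm_mult flip: left_diff_distrib)
    qed (rule h_int)
    finally show ?thesis .
  qed
  have "h t = 0" for t
  proof (rule ccontr)
    assume "h t \<noteq> 0"
    \<comment> \<open>The segment from 0 to \<open>t\<close>, for either sign of \<open>t\<close>;
      it is stable under multiplication by numbers in the unit interval.\<close>
    define I where "I = (\<lambda>c. t * c) ` {0..1}"
    have "compact I" "I \<noteq> {}"
      unfolding I_def by (auto intro!: compact_continuous_image continuous_intros)
    have "t \<in> I" unfolding I_def by (rule image_eqI[of _ _ 1]) auto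
    have "\<exists>x\<in>I. \<forall>y\<in>I. h y \<le> h x"
      by (intro continuous_attains_sup continuous_on_subset[OF h_cont] subset_UNIV) fact+
    then obtain x where x: "x \<in> I" "\<And>y. y \<in> I \<Longrightarrow> h y \<le> h x"
      by blast
    \<comment> \<open>the point of J closest to 0 gives the strict inequality, since multiplication by A moves it out of J\<close>
    define J where "J = I \<inter> h -` {h x}"
    have "compact J" "J \<noteq> {}"
      unfolding J_def using x(1) by (auto intro!: compact_Int_closed \<open>compact I\<close> closed_vimage[OF _ h_cont])
    then have "\<exists>u\<in>J. \<forall>y\<in>J. \<bar>u\<bar> \<le> \<bar>y\<bar>"
      by (intro continuous_attains_inf continuous_on_rabs continuous_on_id)
    then obtain u where u: "u \<in> J" "\<And>y. y \<in> J \<Longrightarrow> \<bar>u\<bar> \<le> \<bar>y\<bar>"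
      by blast
    have "h t \<le> h x" using \<open>t \<in> I\<close> by (rule x(2))
    with \<open>h t \<noteq> 0\<close> h_nonneg[of t] u(1) have "0 < h u" by (auto simp: J_def)
    \<comment> \<open>Needed for \<open>\<bar>u * a\<bar> < \<bar>u\<bar>\<close>, which excludes
      \<open>u * a\<close> from \<open>J\<close>.\<close>
    then have "u \<noteq> 0" using h_0 by auto
    have less: "h (u * a) < h u" if "0 < a" "a < 1" for a
    proof -
      obtain c where "u = t * c" "0 \<le> c" "c \<le> 1"
        using u(1) unfolding I_def J_def by (metis IntD1 imageE atLeastAtMost_iff)
      with that have "u * a = t * (c * a)" "c * a \<in> {0..1}"
        by (auto intro!: mult_le_one)
      then have "u * a \<in> I"
        unfolding I_def by blast
      moreover have "u * a \<notin> J"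
      proof
        assume "u * a \<in> J"
        then have "\<bar>u\<bar> \<le> \<bar>u * a\<bar>" by (rule u(2))
        moreover have "\<bar>u * a\<bar> < \<bar>u\<bar>"
          using that \<open>u \<noteq> 0\<close> by (simp add: abs_mult)
        ultimately show False by simp
      qed
      ultimately have "h (u * a) \<le> h x" "h (u * a) \<noteq> h x"
        using x(2) by (auto simp: J_def)
      then show ?thesis
        using u(1) by (simp add: J_def)
    qed
    have "(\<integral>a. h (u * a) \<partial>A) < (\<integral>a. h u \<partial>A)"
    proof (rule A.integral_less_AE_space)
      show "AE a in A. h (u * a) < h u"
        using A by eventually_elim (rule less)
    qed (use h_int A.emeasure_space_1 in auto)
    also have "\<dots> = h u" by (simp add: A.prob_space del: A.space_eq_univ)
    finally show False using h_le[of u] by simp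
  qed
  then have "char \<mu> = char \<nu>"
    by (auto simp: h_def)
  with assms(3,4) show ?thesis by (rule Levy_uniqueness)
qed
subsection \<open>The hypergeometric identity\<close>

text \<open>The series \<open>(1 - x)\<^bsup>-c\<^esup>\<close>.\<close>

definition gamma_fps :: "real \<Rightarrow> real fps" where
  "gamma_fps c = Abs_fps (\<lambda>n. pochhammer c n / fact n)"

text \<open>Gauss's hypergeometric series F(a, b; c; x), the moment series of D(a, b; c).\<close>

definition gauss_fps :: "real \<Rightarrow> real \<Rightarrow> real \<Rightarrow> real fps" where
  "gauss_fps a b c = Abs_fps (\<lambda>n. pochhammer a n * pochhammer b n / (pochhammer c n * fact n))"

text \<open>The Euler operator x d/dx. It is diagonal on monomials, so multiplying the n-th
  coefficient by a polynomial in \<open>n\<close> amounts to applying that polynomial in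
  \<open>fps_theta\<close>.\<close>

definition fps_theta :: "real fps \<Rightarrow> real fps" where
  "fps_theta f = fps_X * fps_deriv f"

lemma fps_nth_theta [simp]: "fps_nth (fps_theta f) n = of_nat n * fps_nth f n"
  by (cases n) (auto simp: fps_theta_def)

lemma fps_theta_mult: "fps_theta (f * g) = fps_theta f * g + f * fps_theta g"
  by (simp add: fps_theta_def algebra_simps)

lemma fps_theta_add: "fps_theta (f + g) = fps_theta f + fps_theta g"
  by (simp add: fps_theta_def algebra_simps)

text \<open>The coefficients are \<open>n + 1\<close>; each factor \<open>1 - fps_X\<close> takes
  differences, giving first the constant sequence 1 and then the unit series. The identity later
  cancels the squared factor.\<close>

lemma gamma_fps_2: "(1 - fps_X)\<^sup>2 * gamma_fps 2 = 1"
proof -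
  have "pochhammer 2 n = (fact (Suc n) :: real)" for n
    using pochhammer_rec[of "1::real" n] pochhammer_fact[of "Suc n", where 'a = real] by simp
  then have "gamma_fps 2 = Abs_fps (\<lambda>n. of_nat (Suc n))"
    by (simp add: gamma_fps_def fps_eq_iff field_simps)
  also have "(1 - fps_X) * \<dots> = Abs_fps (\<lambda>n. 1)"
    by (auto simp: fps_eq_iff left_diff_distrib fps_X_mult_nth)
  finally have 1: "(1 - fps_X) * gamma_fps 2 = Abs_fps (\<lambda>n. 1)" .
  have "(1 - fps_X) * Abs_fps (\<lambda>n. 1) = (1 :: real fps)"
    by (auto simp: fps_eq_iff left_diff_distrib fps_X_mult_nth)
  with 1 show ?thesis by (simp add: power2_eq_square mult.assoc)
qed

text \<open>The logarithmic derivative of the power of 1 - x, with the denominator cleared; on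
  coefficients it is the recursion of \<open>pochhammer c\<close>.\<close>

lemma gamma_fps_ode:
  "(1 - fps_X) * fps_theta (gamma_fps c) = fps_const c * fps_X * gamma_fps c"
proof (rule fps_ext)
  fix n
  show "fps_nth ((1 - fps_X) * fps_theta (gamma_fps c)) n = fps_nth (fps_const c * fps_X * gamma_fps c) n"
  proof (cases n)
    case (Suc m)
    have "fps_nth (gamma_fps c) (Suc m) * (1 + real m) = fps_nth (gamma_fps c) m * (c + real m)"
      by (simp add: gamma_fps_def pochhammer_Suc del: of_nat_Suc flip: of_nat_Suc)
    with Suc show ?thesis
      by (simp add: left_diff_distrib mult.assoc algebra_simps)
  qed (simp add: left_diff_distrib mult.assoc)
qed

text \<open>The hypergeometric equation \<open>\<theta>(\<theta> + c - 1) F = x (\<theta> +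
  a)(\<theta> + b) F\<close>, which is the two-term recursion of the coefficients. Positivity of
  \<open>c\<close> keeps their denominators nonzero.\<close>

lemma gauss_fps_ode:
  fixes a b c :: real
  assumes "0 < c"
  defines "F \<equiv> gauss_fps a b c"
  shows "fps_theta (fps_theta F) + fps_const (c - 1) * fps_theta F =
    fps_X * (fps_theta (fps_theta F) + (fps_const (a + b) * fps_theta F + fps_const (a * b) * F))"
proof (rule fps_ext)
  fix n
  show "fps_nth (fps_theta (fps_theta F) + fps_const (c - 1) * fps_theta F) n =
    fps_nth (fps_X * (fps_theta (fps_theta F) + (fps_const (a + b) * fps_theta F + fps_const (a * b) * F))) n"
  proof (cases n)
    case (Suc m)
    have "pochhammer c m > 0" using \<open>0 < c\<close> by (rule pochhammer_pos)
    then have "fps_nth F (Suc m) * ((1 + real m) * (c + real m)) = fps_nth F m * ((a + real m) * (b + real m))"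
      using \<open>0 < c\<close> unfolding F_def by (simp add: gauss_fps_def pochhammer_Suc)
    then show ?thesis
      unfolding Suc fps_X_mult_nth by (simp add: algebra_simps)
  qed simp
qed

text \<open>The coefficient form of the differential equation for \<open>\<phi>\<close>. After
  multiplication by the square of 1 - x and elimination of second derivatives, all derivatives
  cancel; the remaining obstruction has the factor \<open>r\<^sup>2 - r - a * b\<close>, which is
  zero by the choice of \<open>\<rho>\<close>.\<close>

lemma hypergeometric_fixed_point_fps:
  fixes \<alpha> \<beta> \<rho> :: real
  assumes "0 < \<alpha> + \<beta> + 1" and \<rho>: "\<rho>\<^sup>2 - \<rho> = \<alpha> * \<beta>"
  defines "\<phi> \<equiv> gauss_fps (\<alpha> + \<rho>) (\<beta> + \<rho>) (\<alpha> + \<beta> + 1) * gamma_fps (- \<rho>)"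
  shows "(real n + \<alpha>) * (real n + \<beta>) * fps_nth \<phi> n = \<alpha> * \<beta> * fps_nth (\<phi> * gamma_fps 2) n"
proof -
  define F where "F = gauss_fps (\<alpha> + \<rho>) (\<beta> + \<rho>) (\<alpha> + \<beta> + 1)"
  define G where "G = gamma_fps (- \<rho>)"
  define X :: "real fps" where "X = fps_X"
  define a b r where "a = fps_const \<alpha>" and "b = fps_const \<beta>" and "r = fps_const \<rho>"
  have theta_X: "fps_theta X = X" "fps_theta (1 - X) = - X" "fps_theta (- r) = 0"
    by (simp_all add: fps_theta_def X_def r_def)
  have ab: "a * b = r\<^sup>2 - r"
    using \<rho> by (simp add: a_def b_def r_def power2_eq_square)
  have G1: "(1 - X) * fps_theta G = - r * X * G"
    using gamma_fps_ode[of "- \<rho>"] by (simp add: X_def r_def G_def flip: fps_const_neg)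
  have "fps_theta ((1 - X) * fps_theta G) = fps_theta ((- r * X) * G)"
    by (simp only: G1)
  then have G2: "(1 - X) * fps_theta (fps_theta G) = X * fps_theta G - r * X * G - r * X * fps_theta G"
    unfolding fps_theta_mult theta_X by (simp add: algebra_simps)
  have "(1 - X)\<^sup>2 * fps_theta (fps_theta G) = (1 - X) * ((1 - X) * fps_theta (fps_theta G))"
    by (simp add: power2_eq_square mult.assoc)
  also have "\<dots> = X * ((1 - X) * fps_theta G) - r * X * (1 - X) * G - r * X * ((1 - X) * fps_theta G)"
    unfolding G2 by (simp add: algebra_simps)
  finally have G2': "(1 - X)\<^sup>2 * fps_theta (fps_theta G) = (r\<^sup>2 - r) * X\<^sup>2 * G - r * X * (1 - X) * G"
    unfolding G1 by (simp add: algebra_simps power2_eq_square)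
  have "fps_theta (fps_theta F) + (a + b) * fps_theta F =
      X * (fps_theta (fps_theta F) + (a + r + (b + r)) * fps_theta F + (a + r) * (b + r) * F)"
    using gauss_fps_ode[OF assms(1), of "\<alpha> + \<rho>" "\<beta> + \<rho>"]
    by (simp add: F_def X_def a_def b_def r_def mult.assoc)
  then have F2: "(1 - X) * fps_theta (fps_theta F) =
      X * ((a + r + (b + r)) * fps_theta F + (a + r) * (b + r) * F) - (a + b) * fps_theta F"
    by (simp add: algebra_simps)
  have \<phi>2: "fps_theta (fps_theta \<phi>) = fps_theta (fps_theta F) * G + 2 * fps_theta F * fps_theta G + F * fps_theta (fps_theta G)"
    and \<phi>1: "fps_theta \<phi> = fps_theta F * G + F * fps_theta G" and \<phi>0: "\<phi> = F * G"
    by (simp_all add: \<phi>_def F_def G_def fps_theta_mult fps_theta_add)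
  \<comment> \<open>The powers of \<open>1 - X\<close> are distributed to match \<open>F2\<close>,
    \<open>G1\<close> and \<open>G2'\<close>: one for the second derivative of \<open>F\<close>, one
    for the first of \<open>G\<close>, two for the second of \<open>G\<close>.\<close>
  have "(1 - X)\<^sup>2 * (fps_theta (fps_theta \<phi>) + (a + b) * fps_theta \<phi> + a * b * \<phi>) =
      (1 - X) * G * ((1 - X) * fps_theta (fps_theta F))
      + (2 * fps_theta F + (a + b) * F) * (1 - X) * ((1 - X) * fps_theta G)
      + F * ((1 - X)\<^sup>2 * fps_theta (fps_theta G))
      + (a + b) * (1 - X)\<^sup>2 * fps_theta F * G + a * b * (1 - X)\<^sup>2 * F * G"
    unfolding \<phi>2 unfolding \<phi>1 unfolding \<phi>0 by (simp add: algebra_simps power2_eq_square)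
  also have "\<dots> = a * b * (F * G) + (r\<^sup>2 - r - a * b) * X * (F * G)"
    unfolding F2 G1 G2' by (simp add: algebra_simps power2_eq_square)
  finally have "(1 - X)\<^sup>2 * (fps_theta (fps_theta \<phi>) + (a + b) * fps_theta \<phi> + a * b * \<phi>) = a * b * \<phi>"
    unfolding ab \<phi>0 by simp
  then have "gamma_fps 2 * ((1 - X)\<^sup>2 * (fps_theta (fps_theta \<phi>) + (a + b) * fps_theta \<phi> + a * b * \<phi>)) = a * b * (\<phi> * gamma_fps 2)"
    by (simp add: mult_ac)
  moreover have "gamma_fps 2 * ((1 - X)\<^sup>2 * f) = f" for f
    using arg_cong[OF gamma_fps_2, of "\<lambda>g. g * f"] by (simp add: X_def mult_ac)
  ultimately have "fps_theta (fps_theta \<phi>) + fps_const (\<alpha> + \<beta>) * fps_theta \<phi> + fps_const (\<alpha> * \<beta>) * \<phi>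
      = fps_const (\<alpha> * \<beta>) * (\<phi> * gamma_fps 2)"
    by (simp add: a_def b_def)
  from arg_cong[OF this, of "\<lambda>f. fps_nth f n"] show ?thesis
    unfolding fps_add_nth fps_mult_left_const_nth fps_nth_theta by (simp add: algebra_simps)
qed

section \<open>Geometric growth of the coefficients\<close>

lemma pochhammer_le_fact:
  fixes a :: real
  assumes "0 \<le> a"
  shows "pochhammer a n \<le> max 1 a ^ n * fact n"
proof (induction n)
  case (Suc n)
  have "a + real n \<le> max 1 a * (1 + real n)"
    using assms mult_right_mono[of 1 "max 1 a" "real n"] by (simp add: algebra_simps)
  with Suc have "pochhammer a n * (a + real n) \<le> (max 1 a ^ n * fact n) * (max 1 a * (1 + real n))"
    using assms by (intro mult_mono) auto
  then show ?case by (simp add: pochhammer_Suc mult_ac)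
qed simp

lemma gamma_fps_nonneg: "0 \<le> a \<Longrightarrow> 0 \<le> fps_nth (gamma_fps a) n"
  by (simp add: gamma_fps_def pochhammer_prod prod_nonneg)

lemma gamma_fps_le: "0 \<le> a \<Longrightarrow> fps_nth (gamma_fps a) n \<le> max 1 a ^ n"
  using pochhammer_le_fact[of a n] by (simp add: gamma_fps_def field_simps)

text \<open>As \<open>a \<le> c\<close>, the quotient of \<open>pochhammer a n\<close> by
  \<open>pochhammer c n\<close> is at most 1.\<close>

lemma gauss_fps_le:
  assumes "0 < a" "a \<le> c" "0 < b"
  shows "fps_nth (gauss_fps a b c) n \<le> fps_nth (gamma_fps b) n"
proof -
  have "pochhammer a n \<le> pochhammer c n"
    unfolding pochhammer_prod using assms by (intro prod_mono) auto
  moreover have "0 < pochhammer c n" "0 < pochhammer b n"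
    using assms by (auto intro: pochhammer_pos)
  ultimately show ?thesis
    by (simp add: gauss_fps_def gamma_fps_def divide_simps)
qed

text \<open>The Cauchy product has \<open>n + 1\<close> terms, at most \<open>2 ^ n\<close>, each
  bounded by \<open>?K ^ n\<close>. This is the growth condition of
  \<open>moments_unique\<close>.\<close>

lemma gauss_gamma_fps_le:
  assumes "0 < a" "a \<le> c" "0 < b" "0 \<le> d"
  shows "fps_nth (gauss_fps a b c * gamma_fps d) n \<le> (2 * (max 1 b * max 1 d)) ^ n"
proof -
  let ?K = "max 1 b * max 1 d"
  have "fps_nth (gauss_fps a b c * gamma_fps d) n =
      (\<Sum>i=0..n. fps_nth (gauss_fps a b c) i * fps_nth (gamma_fps d) (n - i))"
    by (rule fps_mult_nth)
  also have "\<dots> \<le> (\<Sum>i=0..n. ?K ^ n)"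
  proof (rule sum_mono)
    fix i assume i: "i \<in> {0..n}"
    have "fps_nth (gauss_fps a b c) i * fps_nth (gamma_fps d) (n - i) \<le> max 1 b ^ i * max 1 d ^ (n - i)"
      using assms gauss_fps_le[of a c b i] gamma_fps_le[of b i]
      by (intro mult_mono gamma_fps_le gamma_fps_nonneg) auto
    also have "\<dots> \<le> max 1 b ^ n * max 1 d ^ n"
      using i by (intro mult_mono power_increasing) auto
    finally show "fps_nth (gauss_fps a b c) i * fps_nth (gamma_fps d) (n - i) \<le> ?K ^ n"
      by (simp add: power_mult_distrib)
  qed
  also have "\<dots> = real (Suc n) * ?K ^ n" by simp
  also have "\<dots> \<le> 2 ^ n * ?K ^ n"
  proof (intro mult_right_mono)
    have "real (Suc n) \<le> real (2 ^ n)"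
      by (subst of_nat_le_iff) (simp add: Suc_leI)
    then show "real (Suc n) \<le> 2 ^ n" by simp
  qed simp
  finally show ?thesis by (simp add: power_mult_distrib)
qed

subsection \<open>The perpetuity\<close>

lemma has_moment_fps_gamma:
  assumes "is_dufresne_law [c] [] D"
  shows "has_moment_fps D (gamma_fps c)"
  unfolding has_moment_fps_def
proof
  fix n
  show "has_bochner_integral D (\<lambda>x. x ^ n / fact n) (fps_nth (gamma_fps c) n)"
    using has_bochner_integral_divide_zero[OF is_dufresne_law_moments[OF assms], of n "fact n"]
    by (simp add: gamma_fps_def)
qed

lemma has_moment_fps_gauss:
  assumes "is_dufresne_law [a, b] [c] D"
  shows "has_moment_fps D (gauss_fps a b c)"
  unfolding has_moment_fps_def
proof
  fix n
  show "has_bochner_integral D (\<lambda>x. x ^ n / fact n) (fps_nth (gauss_fps a b c) n)"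
    using has_bochner_integral_divide_zero[OF is_dufresne_law_moments[OF assms], of n "fact n"]
    by (simp add: gauss_fps_def)
qed

text \<open>Splitting off either the last or the first factor of \<open>pochhammer a (Suc n)\<close>
  gives the same product.\<close>

lemma pochhammer_plus_1_quotient:
  fixes a :: real
  assumes "0 < a"
  shows "pochhammer a n / pochhammer (a + 1) n = a / (a + real n)"
proof -
  have "pochhammer a n * (a + real n) = a * pochhammer (a + 1) n"
    using pochhammer_Suc[of a n] pochhammer_rec[of a n] by simp
  moreover have "0 < pochhammer (a + 1) n"
    using assms by (intro pochhammer_pos) simp
  ultimately show ?thesis
    using assms by (simp add: divide_simps)
qed

text \<open>Up to the constant \<open>\<alpha> * \<beta>\<close>, these moments are the inverses of
  the eigenvalues of \<open>(\<theta> + \<alpha>)(\<theta> + \<beta>)\<close> on monomials. This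
  links multiplication by \<open>A\<close> to a differential operator.\<close>

lemma is_dufresne_law_beta_product_moments:
  assumes D: "is_dufresne_law [\<alpha>, \<beta>] [\<alpha> + 1, \<beta> + 1] D"
  shows "has_bochner_integral D (\<lambda>x. x ^ n) (\<alpha> * \<beta> / ((real n + \<alpha>) * (real n + \<beta>)))"
proof -
  have "0 < \<alpha>" "0 < \<beta>"
    using D by (auto simp: is_dufresne_law_def)
  then have "(\<Prod>a\<leftarrow>[\<alpha>, \<beta>]. pochhammer a n) / (\<Prod>b\<leftarrow>[\<alpha> + 1, \<beta> + 1]. pochhammer b n) =
      \<alpha> / (\<alpha> + real n) * (\<beta> / (\<beta> + real n))"
    by (simp flip: pochhammer_plus_1_quotient)
  then show ?thesis
    using is_dufresne_law_moments[OF D, of n] by (simp add: add.commute)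
qed

lemma is_dufresne_law_beta_product_less_1:
  assumes D: "is_dufresne_law [\<alpha>, \<beta>] [\<alpha> + 1, \<beta> + 1] D"
  shows "AE x in D. x < 1"
proof (rule AE_less_1_if_moments_tendsto_0[OF is_dufresne_law_real_distribution[OF D]])
  have "AE x in D. 0 < x"
    using D by (simp add: is_dufresne_law_def)
  then show "AE x in D. 0 \<le> x"
    by eventually_elim simp
  show "has_bochner_integral D (\<lambda>x. x ^ n) (\<alpha> * \<beta> / ((real n + \<alpha>) * (real n + \<beta>)))" for n
    by (rule is_dufresne_law_beta_product_moments[OF D])
  show "(\<lambda>n. \<alpha> * \<beta> / ((real n + \<alpha>) * (real n + \<beta>))) \<longlonglongrightarrow> 0"
    by real_asymp
qed

text \<open>Adding \<open>B\<close> multiplies the moment series by \<open>gamma_fps 2\<close>, and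
  multiplying by \<open>A\<close> divides the n-th coefficient by its eigenvalue; the hypergeometric
  identity says that \<open>\<phi>\<close> is restored. Moment determinacy then gives equality of
  laws.\<close>

lemma perpetuity_law:
  assumes \<rho>: "\<rho> < 0" "\<rho>\<^sup>2 - \<rho> = \<alpha> * \<beta>"
    and A: "is_dufresne_law [\<alpha>, \<beta>] [\<alpha> + 1, \<beta> + 1] A"
    and B: "is_dufresne_law [2] [] B"
    and D: "is_dufresne_law [\<alpha> + \<rho>, \<beta> + \<rho>] [\<alpha> + \<beta> + 1] D"
    and E: "is_dufresne_law [- \<rho>] [] E"
  shows "mult_convolution A (convolution (convolution D E) B) = convolution D E"
proof -
  have pos: "0 < \<alpha>" "0 < \<beta>" "0 < \<alpha> + \<rho>" "0 < \<beta> + \<rho>"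
    using A D by (auto simp: is_dufresne_law_def)
  note rd = A[THEN is_dufresne_law_real_distribution] B[THEN is_dufresne_law_real_distribution]
    D[THEN is_dufresne_law_real_distribution] E[THEN is_dufresne_law_real_distribution]
  interpret DE: pair_real_distribution D E
    by (simp add: pair_real_distribution_def rd)
  interpret DEB: pair_real_distribution "convolution D E" B
    by (simp add: pair_real_distribution_def rd DE.real_distribution_convolution)
  interpret ADEB: pair_real_distribution A "convolution (convolution D E) B"
    by (simp add: pair_real_distribution_def rd DEB.real_distribution_convolution)
  have AE: "AE x in A. 0 < x" "AE x in B. 0 < x" "AE x in D. 0 < x" "AE x in E. 0 < x"
    using A B D E by (simp_all add: is_dufresne_law_def)
  have AE_DE: "AE x in convolution D E. 0 < x"
    by (intro DE.AE_convolution_pos AE)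
  have AE_ADEB: "AE x in mult_convolution A (convolution (convolution D E) B). 0 < x"
    by (intro ADEB.AE_mult_convolution_pos DEB.AE_convolution_pos AE AE_DE)
  define \<phi> where "\<phi> = gauss_fps (\<alpha> + \<rho>) (\<beta> + \<rho>) (\<alpha> + \<beta> + 1) * gamma_fps (- \<rho>)"
  have \<phi>: "has_moment_fps (convolution D E) \<phi>"
    unfolding \<phi>_def by (intro DE.has_moment_fps_convolution has_moment_fps_gauss has_moment_fps_gamma D E)
  then have \<phi>_B: "has_moment_fps (convolution (convolution D E) B) (\<phi> * gamma_fps 2)"
    by (intro DEB.has_moment_fps_convolution has_moment_fps_gamma B)
  have "has_bochner_integral (mult_convolution A (convolution (convolution D E) B)) (\<lambda>x. x ^ n / fact n) (fps_nth \<phi> n)" for n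
  proof -
    have "has_bochner_integral (mult_convolution A (convolution (convolution D E) B)) (\<lambda>x. x ^ n / fact n)
        (\<alpha> * \<beta> / ((real n + \<alpha>) * (real n + \<beta>)) * fps_nth (\<phi> * gamma_fps 2) n)"
      using is_dufresne_law_beta_product_moments[OF A] \<phi>_B
      by (intro ADEB.has_bochner_integral_mult_convolution[where P = "\<lambda>_. True" and Q = "\<lambda>_. True"])
        (auto simp: has_moment_fps_def power_mult_distrib)
    \<comment> \<open>The hypergeometric identity, divided by a factor that is positive because
      \<open>\<alpha>\<close> and \<open>\<beta>\<close> are.\<close>
    also have "\<alpha> * \<beta> / ((real n + \<alpha>) * (real n + \<beta>)) * fps_nth (\<phi> * gamma_fps 2) n = fps_nth \<phi> n"
      using hypergeometric_fixed_point_fps[OF _ \<rho>(2), of n] pos unfolding \<phi>_def [symmetric]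
      by (simp add: field_simps add_nonneg_eq_0_iff)
    finally show ?thesis .
  qed
  moreover have "fps_nth \<phi> n \<le> (2 * (max 1 (\<beta> + \<rho>) * max 1 (- \<rho>))) ^ n" for n
    unfolding \<phi>_def using pos \<rho>(1) by (intro gauss_gamma_fps_le) auto
  moreover have "has_bochner_integral (convolution D E) (\<lambda>x. x ^ n / fact n) (fps_nth \<phi> n)" for n
    using \<phi> by (simp add: has_moment_fps_def)
  moreover have "AE x in convolution D E. 0 \<le> x" "AE x in mult_convolution A (convolution (convolution D E) B). 0 \<le> x"
    using AE_DE AE_ADEB by (auto elim: eventually_mono)
  ultimately show ?thesis
    using ADEB.real_distribution_mult_convolution DE.real_distribution_convolution
    by (intro moments_unique[where c = "fps_nth \<phi>"])
qed

lemma distr_mult_add_eq_mult_convolution: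
  fixes A B X :: "'a \<Rightarrow> real"
  assumes "prob_space M"
    and indep: "prob_space.indep_vars M (\<lambda>_. borel) (\<lambda>i. [A, B, X] ! i) {..<3}"
  shows "distr M borel (\<lambda>\<omega>. A \<omega> * (X \<omega> + B \<omega>)) =
    mult_convolution (distr M borel A) (convolution (distr M borel X) (distr M borel B))"
proof -
  interpret prob_space M by fact
  have eqs: "{..<3} = insert 0 {1, 2 :: nat}" "{1, 2} = insert 2 {1 :: nat}"
    by auto
  \<comment> \<open>Indices 0, 1, 2 stand for \<open>A\<close>, \<open>B\<close>, \<open>X\<close>.
    Splitting off index 0 leaves the sum over the other two.\<close>
  have "indep_var borel A borel (\<lambda>\<omega>. B \<omega> + X \<omega>)"
    using indep_vars_sum[of "{1, 2}" 0 "\<lambda>i. [A, B, X] ! i"] indep unfolding eqs(1) by simp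
  then have A_XB: "indep_var borel A borel (\<lambda>\<omega>. X \<omega> + B \<omega>)"
    by (simp add: add.commute)
  \<comment> \<open>The same splitting at index 2 leaves the one-term sum \<open>B\<close>.\<close>
  have "indep_vars (\<lambda>_. borel) (\<lambda>i. [A, B, X] ! i) (insert 2 {1})"
    using indep by (rule indep_vars_subset) auto
  from indep_vars_sum[OF _ _ this] have XB: "indep_var borel X borel B"
    by simp
  have [measurable]: "A \<in> borel_measurable M" "B \<in> borel_measurable M" "X \<in> borel_measurable M"
    using A_XB XB by (auto dest: indep_var_rv1 indep_var_rv2)
  have "mult_convolution (distr M borel A) (distr M borel (\<lambda>\<omega>. X \<omega> + B \<omega>)) = distr M borel (\<lambda>\<omega>. A \<omega> * (X \<omega> + B \<omega>))"
    using A_XB unfolding indep_var_distribution_eq mult_convolution_def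
    by (simp add: distr_distr comp_def)
  then show ?thesis
    by (simp add: sum_indep_random_variable[OF XB])
qed

theorem proposition2:
  fixes M :: "'a measure" and A B X :: "'a \<Rightarrow> real" and \<alpha> \<beta> \<rho> :: real
  assumes "0 < \<alpha>" and "0 < \<beta>"
    and "min \<alpha> \<beta> + 1 > max \<alpha> \<beta>"
    and "\<rho> = (1 - sqrt (1 + 4 * \<alpha> * \<beta>)) / 2"
    and "prob_space M"
    and "prob_space.indep_vars M (\<lambda>_. borel) (\<lambda>i. [A, B, X] ! i) {..<3}"
    and "AE \<omega> in M. 0 < A \<omega>" and "AE \<omega> in M. 0 < B \<omega>" and "AE \<omega> in M. 0 < X \<omega>"
    and "distr M borel A = dufresne [\<alpha>, \<beta>] [\<alpha> + 1, \<beta> + 1]"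
    and "distr M borel B = dufresne [2] []"
  shows "distr M borel X = distr M borel (\<lambda>\<omega>. A \<omega> * (X \<omega> + B \<omega>)) \<longleftrightarrow>
         distr M borel X =
           convolution (dufresne [\<alpha> + \<rho>, \<beta> + \<rho>] [\<alpha> + \<beta> + 1]) (dufresne [- \<rho>] [])"
proof -
  interpret prob_space M by fact
  define r where "r = sqrt (1 + 4 * \<alpha> * \<beta>)"
  have r2: "r\<^sup>2 = 1 + 4 * \<alpha> * \<beta>"
    using assms(1,2) by (simp add: r_def)
  have \<rho>r: "\<rho> = (1 - r) / 2"
    using assms(4) by (simp add: r_def)
  \<comment> \<open>\<open>\<rho>\<close> is the negative root of this quadratic equation.\<close>
  have \<rho>: "\<rho> < 0" "\<rho>\<^sup>2 - \<rho> = \<alpha> * \<beta>"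
    using assms(1,2) r2 by (auto simp: \<rho>r r_def power2_eq_square field_simps)
  \<comment> \<open>Equivalent to positivity of \<open>\<alpha> + \<rho>\<close> and
    \<open>\<beta> + \<rho>\<close>. Squaring reduces the two bounds to
    \<open>\<beta> < \<alpha> + 1\<close> and \<open>\<alpha> < \<beta> + 1\<close>, the hypothesis
    on min and max.\<close>
  have "r < 1 + 2 * \<alpha>" "r < 1 + 2 * \<beta>"
  proof -
    have "\<beta> < \<alpha> + 1" "\<alpha> < \<beta> + 1"
      using assms(3) by linarith+
    then have "1 + 4 * \<alpha> * \<beta> < (1 + 2 * \<alpha>)\<^sup>2" "1 + 4 * \<alpha> * \<beta> < (1 + 2 * \<beta>)\<^sup>2"
      using assms(1,2) mult_strict_left_mono[of \<beta> "\<alpha> + 1" \<alpha>] mult_strict_left_mono[of \<alpha> "\<beta> + 1" \<beta>]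
      by (auto simp: power2_eq_square algebra_simps)
    then show "r < 1 + 2 * \<alpha>" "r < 1 + 2 * \<beta>"
      using assms(1,2) by (auto simp: r_def intro: real_less_lsqrt)
  qed
  then have pos: "0 < \<alpha> + \<rho>" "0 < \<beta> + \<rho>"
    by (auto simp: \<rho>r field_simps)
  \<comment> \<open>Here and below a concrete law is exhibited, and \<open>dufresne_eqI\<close>
    identifies it with the definite description. This one is a product of two independent beta
    variables.\<close>
  have A: "is_dufresne_law [\<alpha>, \<beta>] [\<alpha> + 1, \<beta> + 1] (dufresne [\<alpha>, \<beta>] [\<alpha> + 1, \<beta> + 1])"
    using is_dufresne_law_mult_convolution[OF is_dufresne_law_beta is_dufresne_law_beta, of \<alpha> 1 \<beta> 1] assms(1,2)
    by (simp add: dufresne_eqI)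
  have B: "is_dufresne_law [2] [] (dufresne [2] [])"
    using is_dufresne_law_gamma[of 2] by (simp add: dufresne_eqI)
  have E: "is_dufresne_law [- \<rho>] [] (dufresne [- \<rho>] [])"
    using is_dufresne_law_gamma[of "- \<rho>"] \<rho>(1) by (simp add: dufresne_eqI)
  \<comment> \<open>Existence of this law: a beta variable with parameters
    \<open>\<alpha> + \<rho>\<close> and \<open>\<beta> + 1 - \<rho>\<close>, whose sum is
    \<open>\<alpha> + \<beta> + 1\<close>, times an independent gamma variable with parameter
    \<open>\<beta> + \<rho>\<close>.\<close>
  have D: "is_dufresne_law [\<alpha> + \<rho>, \<beta> + \<rho>] [\<alpha> + \<beta> + 1] (dufresne [\<alpha> + \<rho>, \<beta> + \<rho>] [\<alpha> + \<beta> + 1])"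
    using is_dufresne_law_mult_convolution[OF is_dufresne_law_beta[of "\<alpha> + \<rho>" "\<beta> + 1 - \<rho>"] is_dufresne_law_gamma[of "\<beta> + \<rho>"]]
      pos \<rho>(1) assms(1,2)
    by (simp add: dufresne_eqI algebra_simps)
  let ?D = "dufresne [\<alpha> + \<rho>, \<beta> + \<rho>] [\<alpha> + \<beta> + 1]" and ?E = "dufresne [- \<rho>] []"
  let ?T = "\<lambda>\<mu>. mult_convolution (distr M borel A) (convolution \<mu> (distr M borel B))"
  have fixed: "?T (convolution ?D ?E) = convolution ?D ?E"
    unfolding assms(10,11) by (rule perpetuity_law[OF \<rho> A B D E])
  have [measurable]: "X \<in> borel_measurable M"
    using assms(6) by (auto simp: indep_vars_def2 dest: bspec[of _ _ 2])
  interpret DE: pair_real_distribution ?D ?E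
    using D E by (simp add: pair_real_distribution_def is_dufresne_law_real_distribution)
  have unique: "\<mu> = convolution ?D ?E" if "real_distribution \<mu>" "\<mu> = ?T \<mu>" for \<mu>
  proof (rule perpetuity_law_unique[OF _ _ that(1) DE.real_distribution_convolution _ _ that(2) fixed[symmetric]])
    show "real_distribution (distr M borel A)" "real_distribution (distr M borel B)"
      unfolding assms(10,11) by (rule A[THEN is_dufresne_law_real_distribution] B[THEN is_dufresne_law_real_distribution])+
    show "AE x in distr M borel A. 0 < x"
      unfolding assms(10) using A by (simp add: is_dufresne_law_def)
    show "AE x in distr M borel A. x < 1"
      unfolding assms(10) using A by (rule is_dufresne_law_beta_product_less_1)
  qed
  have X: "real_distribution (distr M borel X)"
    by (intro real_distributionI prob_space_distr) simp_all
  show ?thesis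
    \<comment> \<open>By independence the equality in law reads \<open>\<mu> = ?T \<mu>\<close> for
      the law \<open>\<mu>\<close> of \<open>X\<close>.\<close>
    unfolding distr_mult_add_eq_mult_convolution[OF assms(5,6)]
    using unique[OF X] fixed by metis
qed

end
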